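(* Fix a tree partition of $\omega$ and let $\mathbb B=\mathcal P(\omega)/\mathcal H$. Then $\mathbb B\cong\mathbb B^\omega/\mathrm{Fin}$ as Boolean algebras.
   Context: A tree partition of $\omega$ is a family $\langle A_s:s\in\omega^{<\omega}\rangle$ of infinite subsets of $\omega$ such that $A_\varnothing=\omega$, for each $s$ the family $\{A_{s^\frown n}:n\in\omega\}$ is a partition of $A_s$, and any two distinct points of $\omega$ lie in different cells $A_s\neq A_t$ with $|s|=|t|=n$ for some $n$. For $X\subseteq\omega$ let $T^\infty_X=\{s\in\omega^{<\omega}:X\cap A_s\text{ is infinite}\}$. For $T\subseteq\omega^{<\omega}$ put $\mathrm{Succ}_T(s)=\{n:s^\frown n\in T\}$ and $D(T)=\{s\in T:\mathrm{Succ}_T(s)\text{ is infinite}\}$; $D^0(T)=T$, $D^{\alpha+1}(T)=D(D^\alpha(T))$, $D^\lambda(T)=\bigcap_{\beta<\lambda}D^\beta(T)$ for limit $\lambda$. $\mathcal H=\bigcup_{\alpha<\omega_1}\{X\subseteq\omega:\varnothing\notin D^\alpha(T^\infty_X)\}$, a proper ideal on $\omega$. $\mathbb B^\omega/\mathrm{Fin}$ is the reduced power: sequences $\langle a_n\rangle\in\mathbb B^\omega$ modulo the relation $\langle a_n\rangle\sim\langle a'_n\rangle$ iff $\{n:a_n\ne a'_n\}$ is finite, with coordinatewise Boolean operations. *)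

theory Defs
  imports "HOL-Library.Countable_Set" "HOL-Library.Disjoint_Sets" "HOL-Library.FuncSet"
begin

section \<open>The first uncountable ordinal\<close>

text \<open>The elements of this type, in their order, are the ordinals below \<open>\<omega>\<^sub>1\<close>:
  \<open>cardSuc natLeq\<close> is a well-order of type \<open>\<omega>\<^sub>1\<close>.\<close>

typedef omega1 = "Field (cardSuc natLeq)"
proof -
  have "infinite (Field (cardSuc natLeq))"
    by (simp add: cardSuc_finite[OF natLeq_Card_order] Field_natLeq)
  then show ?thesis
    by (metis all_not_in_conv finite.emptyI)
qed

lemma Well_order_cardSuc_natLeq: "Well_order (cardSuc natLeq)"
  using cardSuc_Card_order[OF natLeq_Card_order] card_order_on_well_order_on by blast

instantiation omega1 :: wellorder
begin

definition less_eq_omega1 :: "omega1 \<Rightarrow> omega1 \<Rightarrow> bool" where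
  "\<alpha> \<le> \<beta> \<longleftrightarrow> (Rep_omega1 \<alpha>, Rep_omega1 \<beta>) \<in> cardSuc natLeq"

definition less_omega1 :: "omega1 \<Rightarrow> omega1 \<Rightarrow> bool" where
  "\<alpha> < \<beta> \<longleftrightarrow> \<alpha> \<le> \<beta> \<and> \<alpha> \<noteq> (\<beta>::omega1)"

instance
proof
  interpret wo_rel "cardSuc natLeq"
    by unfold_locales (rule Well_order_cardSuc_natLeq)
  have anti': "x = y" if "x \<le> y" "y \<le> x" for x y :: omega1
    using that ANTISYM unfolding less_eq_omega1_def antisym_def Rep_omega1_inject[symmetric]
    by blast
  have refl': "x \<le> x" for x :: omega1
    using REFL Rep_omega1[of x] by (auto simp: less_eq_omega1_def refl_on_def)
  fix x y z :: omega1
  show "x = y" if "x \<le> y" "y \<le> x"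
    using that by (rule anti')
  show "x < y \<longleftrightarrow> x \<le> y \<and> \<not> y \<le> x"
    using anti' refl' unfolding less_omega1_def by blast
  show "x \<le> x" by (rule refl')
  show "x \<le> z" if "x \<le> y" "y \<le> z"
    using that TRANS by (auto simp: less_eq_omega1_def trans_def)
  show "x \<le> y \<or> y \<le> x"
    using TOTALS Rep_omega1 by (auto simp: less_eq_omega1_def)
next
  fix P :: "omega1 \<Rightarrow> bool" and a
  assume IH: "\<And>x. (\<And>y. y < x \<Longrightarrow> P y) \<Longrightarrow> P x"
  have "wf (inv_image (cardSuc natLeq - Id) Rep_omega1)"
    using Well_order_cardSuc_natLeq by (auto simp: well_order_on_def)
  then show "P a"
  proof (induction a rule: wf_induct_rule)
    case (less x)
    show ?case
      by (rule IH, rule less) (simp add: less_omega1_def less_eq_omega1_def Rep_omega1_inject)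
  qed
qed

end

context
  includes cardinal_syntax
begin

lemma countable_iff_ordLeq_natLeq: "countable S \<longleftrightarrow> |S| \<le>o natLeq"
proof -
  have "countable S \<longleftrightarrow> |S| \<le>o |UNIV :: nat set|"
    unfolding countable_def by (auto simp: card_of_ordLeq[symmetric])
  also have "\<dots> \<longleftrightarrow> |S| \<le>o natLeq"
    using card_of_nat ordIso_symmetric ordLeq_ordIso_trans by blast
  finally show ?thesis .
qed

lemma uncountable_omega1: "uncountable (UNIV :: omega1 set)"
proof
  assume "countable (UNIV :: omega1 set)"
  then have "countable (Field (cardSuc natLeq))"
    by (metis countable_image type_definition.Rep_range[OF type_definition_omega1])
  then have "cardSuc natLeq \<le>o natLeq"
    unfolding countable_iff_ordLeq_natLeq
    using card_of_Field_ordIso[OF cardSuc_Card_order[OF natLeq_Card_order]]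
      ordIso_ordLeq_trans ordIso_symmetric by blast
  then show False
    using cardSuc_greater[OF natLeq_Card_order] not_ordLess_ordLeq by blast
qed

lemma countable_lessThan_omega1: "countable {..<\<alpha>::omega1}"
proof -
  have "|underS (cardSuc natLeq) (Rep_omega1 \<alpha>)| <o cardSuc natLeq"
    by (rule card_of_underS[OF cardSuc_Card_order[OF natLeq_Card_order] Rep_omega1])
  then have "countable (underS (cardSuc natLeq) (Rep_omega1 \<alpha>))"
    unfolding countable_iff_ordLeq_natLeq
    using cardSuc_ordLeq_ordLess[OF natLeq_Card_order card_of_Card_order] by blast
  moreover have "Rep_omega1 ` {..<\<alpha>} \<subseteq> underS (cardSuc natLeq) (Rep_omega1 \<alpha>)"
    by (auto simp: underS_def less_omega1_def less_eq_omega1_def Rep_omega1_inject)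
  ultimately have "countable (Rep_omega1 ` {..<\<alpha>})"
    by (rule countable_subset[rotated])
  then show ?thesis
    by (rule countable_image_inj_on) (simp add: inj_on_def Rep_omega1_inject)
qed

end


section \<open>Tree partitions and the ideal\<close>

text \<open>Nodes of the tree of finite sequences are lists, and \<open>s @ [n]\<close> is the extension of \<open>s\<close> by \<open>n\<close>. The children of a
  cell form a partition as an indexed family: cells with different indices are disjoint.\<close>

definition tree_partition :: "(nat list \<Rightarrow> nat set) \<Rightarrow> bool" where
  "tree_partition A \<longleftrightarrow>
     (\<forall>s. infinite (A s)) \<and>
     A [] = UNIV \<and>
     (\<forall>s. disjoint_family (\<lambda>n. A (s @ [n])) \<and> (\<Union>n. A (s @ [n])) = A s) \<and>
     (\<forall>x y. x \<noteq> y \<longrightarrow>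
        (\<exists>n s t. length s = n \<and> length t = n \<and> x \<in> A s \<and> y \<in> A t \<and> A s \<noteq> A t))"

definition T_inf :: "(nat list \<Rightarrow> nat set) \<Rightarrow> nat set \<Rightarrow> nat list set" where
  "T_inf A X = {s. infinite (X \<inter> A s)}"

definition Succ :: "nat list set \<Rightarrow> nat list \<Rightarrow> nat set" where
  "Succ T s = {n. s @ [n] \<in> T}"

definition deriv_tree :: "nat list set \<Rightarrow> nat list set" where
  "deriv_tree T = {s \<in> T. infinite (Succ T s)}"

definition is_succ :: "omega1 \<Rightarrow> omega1 \<Rightarrow> bool" where
  "is_succ \<beta> \<alpha> \<longleftrightarrow> \<beta> < \<alpha> \<and> (\<forall>\<gamma>. \<beta> < \<gamma> \<longrightarrow> \<alpha> \<le> \<gamma>)"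

lemma is_succ_the: "is_succ \<beta> \<alpha> \<Longrightarrow> (THE \<beta>. is_succ \<beta> \<alpha>) = \<beta>"
  unfolding is_succ_def by (rule the_equality) (blast, meson leD linorder_neqE)

text \<open>The iterated derivative \<open>D\<^sup>\<alpha>(T)\<close>; the three recursion clauses are
  \<open>deriv_iter_zero\<close>, \<open>deriv_iter_succ\<close> and \<open>deriv_iter_limit\<close> below.\<close>

function deriv_iter :: "omega1 \<Rightarrow> nat list set \<Rightarrow> nat list set" where
  "deriv_iter \<alpha> T =
     (if \<forall>\<beta>. \<alpha> \<le> \<beta> then T
      else if \<exists>\<beta>. is_succ \<beta> \<alpha> then deriv_tree (deriv_iter (THE \<beta>. is_succ \<beta> \<alpha>) T)
      else (\<Inter>\<beta>\<in>{..<\<alpha>}. deriv_iter \<beta> T))"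
  by auto
termination
proof (relation "inv_image {(\<beta>, \<alpha>). \<beta> < \<alpha>} fst")
  show "wf (inv_image {(\<beta>, \<alpha>). \<beta> < (\<alpha>::omega1)} (fst :: omega1 \<times> nat list set \<Rightarrow> omega1))"
    by (rule wf_inv_image) (rule wf)
next
  fix \<alpha> :: omega1 and T :: "nat list set"
  assume "\<exists>\<beta>. is_succ \<beta> \<alpha>"
  then show "((THE \<beta>. is_succ \<beta> \<alpha>, T), \<alpha>, T) \<in> inv_image {(\<beta>, \<alpha>). \<beta> < \<alpha>} fst"
    using is_succ_the by (fastforce simp: is_succ_def)
qed auto

declare deriv_iter.simps [simp del]

lemma deriv_iter_zero: "(\<And>\<beta>. \<alpha> \<le> \<beta>) \<Longrightarrow> deriv_iter \<alpha> T = T"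
  by (subst deriv_iter.simps) simp

lemma deriv_iter_succ: "is_succ \<beta> \<alpha> \<Longrightarrow> deriv_iter \<alpha> T = deriv_tree (deriv_iter \<beta> T)"
  using is_succ_the[of \<beta> \<alpha>]
  by (subst deriv_iter.simps) (metis is_succ_def leD)

lemma deriv_iter_limit:
  assumes "\<not> (\<forall>\<beta>. \<alpha> \<le> \<beta>)" "\<nexists>\<beta>. is_succ \<beta> \<alpha>"
  shows "deriv_iter \<alpha> T = (\<Inter>\<beta>\<in>{..<\<alpha>}. deriv_iter \<beta> T)"
  using assms by (subst deriv_iter.simps) auto

definition ideal_H :: "(nat list \<Rightarrow> nat set) \<Rightarrow> nat set set" where
  "ideal_H A = (\<Union>\<alpha>. {X. [] \<notin> deriv_iter \<alpha> (T_inf A X)})"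


subsection \<open>The family is a proper ideal containing the finite sets\<close>

lemma omega1_cases [case_names zero succ limit]:
  assumes "(\<And>\<beta>. \<alpha> \<le> \<beta>) \<Longrightarrow> P" "\<And>\<beta>. is_succ \<beta> \<alpha> \<Longrightarrow> P"
    "\<not> (\<forall>\<beta>. \<alpha> \<le> \<beta>) \<Longrightarrow> \<nexists>\<beta>. is_succ \<beta> \<alpha> \<Longrightarrow> P"
  shows P
  using assms by blast

lemma deriv_iter_antimono: "\<beta> \<le> \<alpha> \<Longrightarrow> deriv_iter \<alpha> T \<subseteq> deriv_iter \<beta> T"
proof (induction \<alpha> arbitrary: \<beta> rule: less_induct)
  case (less \<alpha>)
  show ?case
  proof (cases "\<beta> = \<alpha>")
    case False
    then have lt: "\<beta> < \<alpha>" using less.prems by simp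
    show ?thesis
    proof (cases \<alpha> rule: omega1_cases)
      case zero then show ?thesis using lt leD by blast
    next
      case (succ \<gamma>)
      then have "\<beta> \<le> \<gamma>" "\<gamma> < \<alpha>" using lt unfolding is_succ_def by (meson leD leI)+
      then have "deriv_iter \<gamma> T \<subseteq> deriv_iter \<beta> T" using less.IH by blast
      then show ?thesis using deriv_iter_succ[OF succ] unfolding deriv_tree_def by blast
    next
      case limit
      then show ?thesis using deriv_iter_limit[OF limit] lt by blast
    qed
  qed simp
qed

lemma deriv_iter_mono: "S \<subseteq> T \<Longrightarrow> deriv_iter \<alpha> S \<subseteq> deriv_iter \<alpha> T"
proof (induction \<alpha> rule: less_induct)
  case (less \<alpha>)
  show ?case
  proof (cases \<alpha> rule: omega1_cases)
    case zero then show ?thesis using less.prems by (simp add: deriv_iter_zero)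
  next
    case (succ \<gamma>)
    then have "deriv_iter \<gamma> S \<subseteq> deriv_iter \<gamma> T" using less unfolding is_succ_def by blast
    then have "Succ (deriv_iter \<gamma> S) s \<subseteq> Succ (deriv_iter \<gamma> T) s" for s
      unfolding Succ_def by blast
    then have "infinite (Succ (deriv_iter \<gamma> S) s) \<Longrightarrow> infinite (Succ (deriv_iter \<gamma> T) s)" for s
      by (meson finite_subset)
    then show ?thesis
      using \<open>deriv_iter \<gamma> S \<subseteq> deriv_iter \<gamma> T\<close>
      by (auto simp: deriv_iter_succ[OF succ] deriv_tree_def)
  next
    case limit
    then show ?thesis using less unfolding deriv_iter_limit[OF limit] by blast
  qed
qed

lemma deriv_iter_closed:
  assumes T: "\<And>s n. s @ [n] \<in> T \<Longrightarrow> s \<in> T"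
  shows "infinite (Succ (deriv_iter \<alpha> T) s) \<Longrightarrow> s \<in> deriv_iter \<alpha> T"
proof (induction \<alpha> rule: less_induct)
  case (less \<alpha>)
  have sub: "infinite (Succ (deriv_iter \<beta> T) s)" if "\<beta> \<le> \<alpha>" for \<beta>
  proof -
    have "Succ (deriv_iter \<alpha> T) s \<subseteq> Succ (deriv_iter \<beta> T) s"
      using deriv_iter_antimono[OF that] unfolding Succ_def by blast
    then show ?thesis using less.prems finite_subset by blast
  qed
  show ?case
  proof (cases \<alpha> rule: omega1_cases)
    case zero 
    then have eq: "deriv_iter \<alpha> T = T" by (rule deriv_iter_zero)
    have "Succ T s \<noteq> {}" using less.prems eq by auto
    then obtain n where "s @ [n] \<in> T" unfolding Succ_def by blast
    then show ?thesis unfolding eq by (rule T)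
  next
    case (succ \<gamma>)
    then have "\<gamma> < \<alpha>" unfolding is_succ_def by blast
    then have "infinite (Succ (deriv_iter \<gamma> T) s)" "s \<in> deriv_iter \<gamma> T"
      using less.IH[of \<gamma>] sub[of \<gamma>] by simp_all
    then show ?thesis
      by (simp add: deriv_iter_succ[OF succ] deriv_tree_def)
  next
    case limit
    then show ?thesis using less.IH sub unfolding deriv_iter_limit[OF limit] by auto
  qed
qed

lemma deriv_iter_Un:
  assumes S: "\<And>s n. s @ [n] \<in> S \<Longrightarrow> s \<in> S"
  assumes T: "\<And>s n. s @ [n] \<in> T \<Longrightarrow> s \<in> T"
  shows "deriv_iter \<alpha> (S \<union> T) \<subseteq> deriv_iter \<alpha> S \<union> deriv_iter \<alpha> T"
proof (induction \<alpha> rule: less_induct)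
  case (less \<alpha>)
  show ?case
  proof (cases \<alpha> rule: omega1_cases)
    case zero then show ?thesis by (simp add: deriv_iter_zero)
  next
    case (succ \<gamma>)
    then have "\<gamma> < \<alpha>" unfolding is_succ_def by blast
    then have IH: "deriv_iter \<gamma> (S \<union> T) \<subseteq> deriv_iter \<gamma> S \<union> deriv_iter \<gamma> T" using less by blast
    show ?thesis
    proof
      fix s assume "s \<in> deriv_iter \<alpha> (S \<union> T)"
      then have "infinite (Succ (deriv_iter \<gamma> (S \<union> T)) s)"
        unfolding deriv_iter_succ[OF succ] deriv_tree_def by simp
      moreover have "Succ (deriv_iter \<gamma> (S \<union> T)) s \<subseteq> Succ (deriv_iter \<gamma> S) s \<union> Succ (deriv_iter \<gamma> T) s"
        using IH unfolding Succ_def by blast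
      ultimately have "infinite (Succ (deriv_iter \<gamma> S) s) \<or> infinite (Succ (deriv_iter \<gamma> T) s)"
        by (meson finite_Un finite_subset)
      moreover have "infinite (Succ (deriv_iter \<gamma> S) s) \<Longrightarrow> s \<in> deriv_iter \<gamma> S"
        by (rule deriv_iter_closed) (rule S)
      moreover have "infinite (Succ (deriv_iter \<gamma> T) s) \<Longrightarrow> s \<in> deriv_iter \<gamma> T"
        by (rule deriv_iter_closed) (rule T)
      ultimately show "s \<in> deriv_iter \<alpha> S \<union> deriv_iter \<alpha> T"
        by (auto simp: deriv_iter_succ[OF succ] deriv_tree_def)
    qed
  next
    case limit
    show ?thesis
    proof
      fix s assume s: "s \<in> deriv_iter \<alpha> (S \<union> T)"
      show "s \<in> deriv_iter \<alpha> S \<union> deriv_iter \<alpha> T"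
      proof (rule ccontr)
        assume "\<not> ?thesis"
        then obtain \<beta> \<gamma> where "\<beta> < \<alpha>" "s \<notin> deriv_iter \<beta> S" "\<gamma> < \<alpha>" "s \<notin> deriv_iter \<gamma> T"
          unfolding deriv_iter_limit[OF limit] by auto
        moreover define \<delta> where "\<delta> = max \<beta> \<gamma>"
        ultimately have "\<delta> < \<alpha>" "s \<notin> deriv_iter \<delta> S" "s \<notin> deriv_iter \<delta> T"
          using deriv_iter_antimono[of \<beta> \<delta> S] deriv_iter_antimono[of \<gamma> \<delta> T] by auto
        then show False using less[of \<delta>] s unfolding deriv_iter_limit[OF limit] by blast
      qed
    qed
  qed
qed

lemma deriv_iter_UNIV: "deriv_iter \<alpha> UNIV = UNIV"
proof (induction \<alpha> rule: less_induct)
  case (less \<alpha>)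
  show ?case
  proof (cases \<alpha> rule: omega1_cases)
    case zero then show ?thesis by (simp add: deriv_iter_zero)
  next
    case (succ \<gamma>)
    then have "deriv_iter \<gamma> UNIV = UNIV" using less unfolding is_succ_def by blast
    then show ?thesis
      by (simp add: deriv_iter_succ[OF succ] deriv_tree_def Succ_def)
  next
    case limit
    then show ?thesis using less unfolding deriv_iter_limit[OF limit] by auto
  qed
qed

lemma T_inf_prefix: "tree_partition A \<Longrightarrow> s @ [n] \<in> T_inf A X \<Longrightarrow> s \<in> T_inf A X"
proof -
  assume "tree_partition A" and *: "s @ [n] \<in> T_inf A X"
  then have "X \<inter> A (s @ [n]) \<subseteq> X \<inter> A s" unfolding tree_partition_def by blast
  then show ?thesis using * finite_subset unfolding T_inf_def by blast
qed

lemma ideal_H_Un: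
  assumes A: "tree_partition A" and "X \<in> ideal_H A" "Y \<in> ideal_H A"
  shows "X \<union> Y \<in> ideal_H A"
proof -
  obtain \<beta> \<gamma> where *: "[] \<notin> deriv_iter \<beta> (T_inf A X)" "[] \<notin> deriv_iter \<gamma> (T_inf A Y)"
    using assms unfolding ideal_H_def by auto
  define \<delta> where "\<delta> = max \<beta> \<gamma>"
  have "[] \<notin> deriv_iter \<delta> (T_inf A X)" "[] \<notin> deriv_iter \<delta> (T_inf A Y)"
    using * deriv_iter_antimono[of \<beta> \<delta>] deriv_iter_antimono[of \<gamma> \<delta>] unfolding \<delta>_def by auto
  moreover have "T_inf A (X \<union> Y) = T_inf A X \<union> T_inf A Y"
    unfolding T_inf_def by (auto simp: Int_Un_distrib2)
  moreover have "deriv_iter \<delta> (T_inf A X \<union> T_inf A Y)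
      \<subseteq> deriv_iter \<delta> (T_inf A X) \<union> deriv_iter \<delta> (T_inf A Y)"
    by (rule deriv_iter_Un) (rule T_inf_prefix[OF A], assumption)+
  ultimately have "[] \<notin> deriv_iter \<delta> (T_inf A (X \<union> Y))" by auto
  then show ?thesis unfolding ideal_H_def by blast
qed

lemma ideal_H_subset: "X \<in> ideal_H A \<Longrightarrow> Y \<subseteq> X \<Longrightarrow> Y \<in> ideal_H A"
proof -
  assume X: "X \<in> ideal_H A" and "Y \<subseteq> X"
  have "T_inf A Y \<subseteq> T_inf A X"
  proof
    fix s assume "s \<in> T_inf A Y"
    moreover have "Y \<inter> A s \<subseteq> X \<inter> A s" using \<open>Y \<subseteq> X\<close> by blast
    ultimately show "s \<in> T_inf A X" unfolding T_inf_def using finite_subset by blast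
  qed
  then have "deriv_iter \<alpha> (T_inf A Y) \<subseteq> deriv_iter \<alpha> (T_inf A X)" for \<alpha>
    by (rule deriv_iter_mono)
  then show ?thesis using X unfolding ideal_H_def by blast
qed

lemma ideal_H_proper: "tree_partition A \<Longrightarrow> UNIV \<notin> ideal_H A"
proof -
  assume "tree_partition A"
  then have "T_inf A UNIV = UNIV" unfolding T_inf_def tree_partition_def by auto
  then show ?thesis unfolding ideal_H_def by (simp add: deriv_iter_UNIV)
qed

lemma ideal_H_finite: "finite X \<Longrightarrow> X \<in> ideal_H A"
proof -
  assume "finite X"
  then have "T_inf A X = {}" unfolding T_inf_def by auto
  moreover have "deriv_iter (LEAST \<alpha>. True) {} = {}"
    by (rule deriv_iter_zero) (simp add: Least_le)
  ultimately have "[] \<notin> deriv_iter (LEAST \<alpha>. True) (T_inf A X)" by simp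
  then show ?thesis unfolding ideal_H_def by blast
qed


section \<open>Boolean algebras, quotients and reduced powers\<close>

record 'a bool_alg =
  ba_carrier :: "'a set"
  ba_meet :: "'a \<Rightarrow> 'a \<Rightarrow> 'a"
  ba_join :: "'a \<Rightarrow> 'a \<Rightarrow> 'a"
  ba_compl :: "'a \<Rightarrow> 'a"
  ba_zero :: 'a
  ba_one :: 'a

definition ba_iso :: "'a bool_alg \<Rightarrow> 'b bool_alg \<Rightarrow> ('a \<Rightarrow> 'b) set" where
  "ba_iso B C = {h.
     bij_betw h (ba_carrier B) (ba_carrier C) \<and>
     (\<forall>x\<in>ba_carrier B. \<forall>y\<in>ba_carrier B. h (ba_meet B x y) = ba_meet C (h x) (h y)) \<and>
     (\<forall>x\<in>ba_carrier B. \<forall>y\<in>ba_carrier B. h (ba_join B x y) = ba_join C (h x) (h y)) \<and>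
     (\<forall>x\<in>ba_carrier B. h (ba_compl B x) = ba_compl C (h x)) \<and>
     h (ba_zero B) = ba_zero C \<and> h (ba_one B) = ba_one C}"

definition ba_isomorphic :: "'a bool_alg \<Rightarrow> 'b bool_alg \<Rightarrow> bool" where
  "ba_isomorphic B C \<longleftrightarrow> ba_iso B C \<noteq> {}"

text \<open>Quotient by a congruence \<open>r\<close> on the carrier. Since \<open>r\<close> is a congruence, all sets in each of
  the unions below coincide, and the union is the class of the operation applied to
  arbitrary representatives.\<close>

definition ba_quotient :: "'a bool_alg \<Rightarrow> 'a rel \<Rightarrow> 'a set bool_alg" where
  "ba_quotient B r = \<lparr>
     ba_carrier = ba_carrier B // r,
     ba_meet = (\<lambda>U V. \<Union>x\<in>U. \<Union>y\<in>V. r `` {ba_meet B x y}),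
     ba_join = (\<lambda>U V. \<Union>x\<in>U. \<Union>y\<in>V. r `` {ba_join B x y}),
     ba_compl = (\<lambda>U. \<Union>x\<in>U. r `` {ba_compl B x}),
     ba_zero = r `` {ba_zero B},
     ba_one = r `` {ba_one B}\<rparr>"

definition ba_powerset :: "'a set bool_alg" where
  "ba_powerset = \<lparr>
     ba_carrier = UNIV,
     ba_meet = (\<inter>),
     ba_join = (\<union>),
     ba_compl = uminus,
     ba_zero = {},
     ba_one = UNIV\<rparr>"

text \<open>\<open>I\<close> is meant to be an ideal; for \<open>ideal_H A\<close> see \<open>ideal_H_Un\<close> and \<open>ideal_H_subset\<close>.\<close>

definition powerset_mod :: "'a set set \<Rightarrow> 'a set set bool_alg" where
  "powerset_mod I = ba_quotient ba_powerset {(X, Y). sym_diff X Y \<in> I}"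

definition ba_power :: "'a bool_alg \<Rightarrow> (nat \<Rightarrow> 'a) bool_alg" where
  "ba_power B = \<lparr>
     ba_carrier = UNIV \<rightarrow> ba_carrier B,
     ba_meet = (\<lambda>a b n. ba_meet B (a n) (b n)),
     ba_join = (\<lambda>a b n. ba_join B (a n) (b n)),
     ba_compl = (\<lambda>a n. ba_compl B (a n)),
     ba_zero = (\<lambda>n. ba_zero B),
     ba_one = (\<lambda>n. ba_one B)\<rparr>"

definition reduced_power_Fin :: "'a bool_alg \<Rightarrow> (nat \<Rightarrow> 'a) set bool_alg" where
  "reduced_power_Fin B = ba_quotient (ba_power B)
     {(a, b). a \<in> ba_carrier (ba_power B) \<and> b \<in> ba_carrier (ba_power B) \<and>
              finite {n. a n \<noteq> b n}}"

end

theory Submission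
  imports Defs
begin

text \<open>
  Write \<open>H\<close> for the ideal. A set \<open>X\<close> lies in \<open>H\<close> iff the root leaves the iterated derivatives of
  \<open>T_inf A X\<close> at some countable stage. Countably many stages have a countable bound, so the root leaves iff
  all but finitely many of its children do, each in its own subtree (\<open>small_iff_deriv_iter\<close>,
  \<open>small_iff_children\<close>). Hence \<open>X \<in> H\<close> iff \<open>X \<inter> A [n]\<close> is in the ideal \<open>H\<^sub>n\<close> of the induced tree partition
  of \<open>A [n]\<close> for all but finitely many \<open>n\<close>, which says that \<open>P(\<omega>)/H\<close> is the product of the algebras
  \<open>P(A [n])/H\<^sub>n\<close> modulo \<open>Fin\<close>.

  Each factor is isomorphic to \<open>P(\<omega>)/H\<close> itself, because a countable set has only one tree partition
  up to isomorphism (\<open>tree_partition_isomorphism\<close>). A point amounts to the branch of \<open>\<omega>\<^sup>\<omega>\<close> through the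
  cells that contain it, so a tree partition is a countable dense subset of Baire space. Any two
  such subsets are isometric for the usual ultrametric by back and forth: when a new point leaves
  its nearest neighbour among the finitely many points treated so far at some node, a partner is
  found in one of the infinitely many cells below the corresponding node that contain no earlier
  partner. An isometry permutes the cells of each level and respects the tree order, hence carries
  one ideal to the other (\<open>small_transfer\<close>). Composing the two facts yields injections \<open>g n\<close> of \<open>\<omega>\<close>
  with disjoint ranges such that \<open>X \<in> H\<close> iff \<open>g n -` X \<in> H\<close> for all but finitely many \<open>n\<close>
  (\<open>ideal_H_self_similar\<close>), and then \<open>X \<mapsto> \<langle>g n -` X\<rangle>\<close> induces the isomorphism.
\<close>

section \<open>Tree partitions of an arbitrary set\<close>

text \<open>As a function of \<open>k\<close> this relation records the ultrametric distance of the branches of \<open>x\<close> and \<open>y\<close>: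
  it holds up to the level at which the branches split. It does not mention the labels of the
  cells, so that it can be compared between different tree partitions.\<close>

definition same_cell :: "(nat list \<Rightarrow> 'a set) \<Rightarrow> nat \<Rightarrow> 'a \<Rightarrow> 'a \<Rightarrow> bool" where
  "same_cell C k x y \<longleftrightarrow> (\<exists>s. length s = k \<and> x \<in> C s \<and> y \<in> C s)"

locale tree_partition_on =
  fixes U :: "'a set" and C :: "nat list \<Rightarrow> 'a set"
  assumes root: "C [] = U"
    and infinite_cell: "infinite (C s)"
    and children_disjoint: "x \<in> C (s @ [m]) \<Longrightarrow> x \<in> C (s @ [n]) \<Longrightarrow> m = n"
    and children_cover: "(\<Union>n. C (s @ [n])) = C s"
    and separated: "x \<in> U \<Longrightarrow> y \<in> U \<Longrightarrow> (\<And>k. same_cell C k x y) \<Longrightarrow> x = y"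
begin

lemma child_subset: "C (s @ [n]) \<subseteq> C s"
  using children_cover[of s] by blast

lemma in_child: "x \<in> C s \<Longrightarrow> \<exists>n. x \<in> C (s @ [n])"
  using children_cover[of s] by blast

lemma append_subset: "C (s @ t) \<subseteq> C s"
proof (induction t rule: rev_induct)
  case (snoc n t)
  then show ?case using child_subset[of "s @ t" n] by auto
qed simp

lemma cell_subset: "C s \<subseteq> U"
  using append_subset[of "[]" s] root by simp

lemma cell_unique: "length s = length t \<Longrightarrow> x \<in> C s \<Longrightarrow> x \<in> C t \<Longrightarrow> s = t"
proof (induction s arbitrary: t rule: rev_induct)
  case (snoc m s)
  then obtain t' n where t: "t = t' @ [n]" by (metis append_butlast_last_id length_0_conv snoc_eq_iff_butlast)
  then have "s = t'" using snoc child_subset by (metis length_append_singleton nat.inject subsetD)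
  then show ?case using children_disjoint snoc.prems t by metis
qed simp

lemma cell_exists: "x \<in> U \<Longrightarrow> \<exists>s. length s = k \<and> x \<in> C s"
proof (induction k)
  case (Suc k)
  then obtain s where "length s = k" "x \<in> C s" by blast
  moreover obtain n where "x \<in> C (s @ [n])" using in_child \<open>x \<in> C s\<close> by blast
  ultimately show ?case by (intro exI[of _ "s @ [n]"]) simp
qed (use root in simp)

lemma same_cell_refl: "x \<in> U \<Longrightarrow> same_cell C k x x"
  unfolding same_cell_def using cell_exists by blast

lemma same_cell_sym: "same_cell C k x y \<Longrightarrow> same_cell C k y x"
  unfolding same_cell_def by blast

lemma same_cell_trans: "same_cell C k x y \<Longrightarrow> same_cell C k y z \<Longrightarrow> same_cell C k x z"
  unfolding same_cell_def using cell_unique by metis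

lemma same_cell_mem: "same_cell C (length s) x y \<Longrightarrow> x \<in> C s \<Longrightarrow> y \<in> C s"
  unfolding same_cell_def using cell_unique by metis

lemma same_cell_antimono:
  assumes "same_cell C k x y" "j \<le> k"
  shows "same_cell C j x y"
proof -
  obtain s where s: "length s = k" "x \<in> C s" "y \<in> C s"
    using assms unfolding same_cell_def by blast
  have "C s \<subseteq> C (take j s)" using append_subset[of "take j s" "drop j s"] by simp
  then show ?thesis
    unfolding same_cell_def using s assms(2) by (intro exI[of _ "take j s"]) auto
qed

lemma subtree: "tree_partition_on (C [n]) (\<lambda>s. C (n # s))"
proof
  fix s x m l
  show "C [n] = C [n]" by simp
  show "infinite (C (n # s))" by (rule infinite_cell)
  show "m = l" if "x \<in> C (n # s @ [m])" "x \<in> C (n # s @ [l])"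
    using children_disjoint[of x "n # s"] that by simp
  show "(\<Union>m. C (n # s @ [m])) = C (n # s)"
    using children_cover[of "n # s"] by simp
next
  fix x y
  assume xy: "x \<in> C [n]" "y \<in> C [n]" and same: "\<And>k. same_cell (\<lambda>s. C (n # s)) k x y"
  have "same_cell C k x y" for k
  proof -
    obtain s where "length s = k" "x \<in> C (n # s)" "y \<in> C (n # s)"
      using same unfolding same_cell_def by blast
    then have "same_cell C (Suc k) x y"
      unfolding same_cell_def by (intro exI[of _ "n # s"]) simp
    then show ?thesis by (rule same_cell_antimono) simp
  qed
  then show "x = y" using separated xy cell_subset by blast
qed

end

text \<open>Separation by different cells, \<open>A s \<noteq> A t\<close>, amounts to not sharing a cell at some level because
  the cells of one level are disjoint.\<close>

lemma tree_partition_on_UNIV: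
  assumes "tree_partition A"
  shows "tree_partition_on UNIV A"
proof
  fix s x m n
  show "A [] = UNIV" "infinite (A s)" "(\<Union>n. A (s @ [n])) = A s"
    using assms unfolding tree_partition_def by blast+
  show uniq: "m = n" if "x \<in> A (s @ [m])" "x \<in> A (s @ [n])" for s x m n
    using assms that unfolding tree_partition_def disjoint_family_on_def by blast
  have cell: "s = t" if "length s = length t" "x \<in> A s" "x \<in> A t" for s t x
    using that
  proof (induction s arbitrary: t rule: rev_induct)
    case (snoc m s)
    then obtain t' n where t: "t = t' @ [n]"
      by (metis append_butlast_last_id length_0_conv snoc_eq_iff_butlast)
    have "A (r @ [i]) \<subseteq> A r" for r i
      using assms unfolding tree_partition_def by blast
    then have "s = t'" using snoc t by (metis length_append_singleton nat.inject subsetD)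
    then show ?case using uniq snoc.prems t by metis
  qed simp
  fix x y assume same: "\<And>k. same_cell A k x y"
  show "x = y"
  proof (rule ccontr)
    assume "x \<noteq> y"
    then obtain s t where "length s = length t" "x \<in> A s" "y \<in> A t" "A s \<noteq> A t"
      using assms unfolding tree_partition_def by metis
    then show False
      using same[of "length s"] cell unfolding same_cell_def by metis
  qed
qed

section \<open>Uniqueness of the tree partition of a countable set\<close>

text \<open>Partial isometries. By separation such a relation is automatically single-valued and injective
  on \<open>U \<times> V\<close>.\<close>

definition partial_iso ::
  "(nat list \<Rightarrow> 'a set) \<Rightarrow> (nat list \<Rightarrow> 'b set) \<Rightarrow> ('a \<times> 'b) set \<Rightarrow> bool" where
  "partial_iso C D p \<longleftrightarrow>
     (\<forall>(x, y)\<in>p. \<forall>(x', y')\<in>p. \<forall>k. same_cell C k x x' \<longleftrightarrow> same_cell D k y y')"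

lemma partial_iso_converse: "partial_iso C D p \<Longrightarrow> partial_iso D C (p\<inverse>)"
  unfolding partial_iso_def by fast

text \<open>Let \<open>K\<close> be the last level at which \<open>x\<close> shares a cell with a point \<open>x0\<close> of the domain. Up to level \<open>K\<close>
  the position of \<open>x\<close> relative to the domain is that of \<open>x0\<close>, and beyond \<open>K\<close> it is separated from the whole
  domain. A point with the same behaviour relative to the range lies in the level-\<open>K\<close> cell of the partner
  \<open>y0\<close> of \<open>x0\<close>, in a child of that cell which the finite range misses.\<close>

lemma partial_iso_extend:
  assumes "tree_partition_on U C" "tree_partition_on V D"
    and p: "finite p" "p \<subseteq> U \<times> V" "partial_iso C D p" and x: "x \<in> U"
  shows "\<exists>y\<in>V. partial_iso C D (insert (x, y) p)"
proof -
  interpret C: tree_partition_on U C by fact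
  interpret D: tree_partition_on V D by fact
  have iso: "same_cell C k x1 x2 \<longleftrightarrow> same_cell D k y1 y2"
    if "(x1, y1) \<in> p" "(x2, y2) \<in> p" for k x1 x2 y1 y2
    using p(3) that unfolding partial_iso_def by blast
  have suff: "partial_iso C D (insert (x, y) p)"
    if "y \<in> V" and *: "\<And>x' y' k. (x', y') \<in> p \<Longrightarrow> same_cell C k x x' \<longleftrightarrow> same_cell D k y y'" for y
    unfolding partial_iso_def
  proof (clarify)
    fix x1 y1 x2 y2 k
    assume 1: "(x1, y1) \<in> insert (x, y) p" and 2: "(x2, y2) \<in> insert (x, y) p"
    have sym: "same_cell C k x' x \<longleftrightarrow> same_cell D k y' y" if "(x', y') \<in> p" for x' y'
      using *[OF that] C.same_cell_sym D.same_cell_sym by blast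
    show "same_cell C k x1 x2 \<longleftrightarrow> same_cell D k y1 y2"
    proof (cases "(x1, y1) \<in> p"; cases "(x2, y2) \<in> p")
      assume "(x1, y1) \<notin> p" "(x2, y2) \<notin> p"
      then show ?thesis
        using 1 2 C.same_cell_refl[OF x] D.same_cell_refl[OF \<open>y \<in> V\<close>] by simp
    qed (use 1 2 iso * sym in auto)
  qed
  consider "x \<in> Domain p" | "p = {}" | "x \<notin> Domain p" "p \<noteq> {}" by blast
  then show ?thesis
  proof cases
    case 1
    then obtain y where "(x, y) \<in> p" by blast
    then show ?thesis using p by (metis SigmaD2 insert_absorb subsetD)
  next
    case 2
    have "V \<noteq> {}" using D.infinite_cell[of "[]"] D.root by auto
    then show ?thesis using suff 2 by blast
  next
    case 3
    define S where "S = {k. \<exists>(x', y')\<in>p. same_cell C k x x'}"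
    have "finite {k. same_cell C k x x'}" if "(x', y') \<in> p" for x' y'
    proof -
      have "x' \<in> U" "x \<noteq> x'" using that p 3 by auto
      then obtain k where k: "\<not> same_cell C k x x'" using C.separated x by blast
      have "{k. same_cell C k x x'} \<subseteq> {..k}"
        using k C.same_cell_antimono by (metis atMost_iff linear mem_Collect_eq subsetI)
      then show ?thesis using finite_subset by blast
    qed
    moreover have "S = (\<Union>(x', y')\<in>p. {k. same_cell C k x x'})" unfolding S_def by blast
    ultimately have "finite S" using p(1) by auto
    have "0 \<in> S"
      using 3 p x C.root unfolding S_def same_cell_def by fastforce
    define K where "K = Max S"
    have "K \<in> S" "\<And>k. k \<in> S \<Longrightarrow> k \<le> K"
      using \<open>finite S\<close> \<open>0 \<in> S\<close> unfolding K_def by (auto intro: Max_in)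
    then obtain x0 y0 where 0: "(x0, y0) \<in> p" "same_cell C K x x0"
      unfolding S_def by blast
    obtain t where t: "length t = K" "y0 \<in> D t"
      using D.cell_exists[of y0 K] 0 p(2) by blast
    have "finite {m. y' \<in> D (t @ [m])}" for y'
    proof (cases "\<exists>m. y' \<in> D (t @ [m])")
      case True
      then obtain m where "y' \<in> D (t @ [m])" ..
      then have "{m. y' \<in> D (t @ [m])} \<subseteq> {m}" using D.children_disjoint by auto
      then show ?thesis by (rule finite_subset) simp
    qed simp
    then have "finite (\<Union>y'\<in>snd ` p. {m. y' \<in> D (t @ [m])})" using p(1) by blast
    then obtain m where m: "\<And>x' y'. (x', y') \<in> p \<Longrightarrow> y' \<notin> D (t @ [m])"
      using ex_new_if_finite[OF infinite_UNIV_nat] by force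
    obtain y where y: "y \<in> D (t @ [m])"
      using D.infinite_cell by (metis all_not_in_conv finite.emptyI)
    have yt: "y \<in> D t" using y D.child_subset by blast
    then have yV: "y \<in> V" using D.cell_subset by blast
    have yy0: "same_cell D K y y0" unfolding same_cell_def using t yt by blast
    have "same_cell C k x x' \<longleftrightarrow> same_cell D k y y'" if xy': "(x', y') \<in> p" for x' y' k
    proof (cases "k \<le> K")
      case True
      then have "same_cell C k x x0" "same_cell D k y y0"
        using C.same_cell_antimono D.same_cell_antimono 0 yy0 by blast+
      then have "same_cell C k x x' \<longleftrightarrow> same_cell C k x0 x'"
        "same_cell D k y y' \<longleftrightarrow> same_cell D k y0 y'"
        using C.same_cell_trans C.same_cell_sym D.same_cell_trans D.same_cell_sym by blast+
      then show ?thesis using iso[OF 0(1) xy'] by simp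
    next
      case False
      then have "\<not> same_cell C k x x'"
        using \<open>\<And>k. k \<in> S \<Longrightarrow> k \<le> K\<close> xy' unfolding S_def by blast
      moreover have "\<not> same_cell D k y y'"
      proof
        assume "same_cell D k y y'"
        then have "same_cell D (length (t @ [m])) y y'"
          by (rule D.same_cell_antimono) (use False t in simp)
        then show False using D.same_cell_mem y m xy' by blast
      qed
      ultimately show ?thesis by simp
    qed
    then show ?thesis using suff yV by blast
  qed
qed

text \<open>Back and forth along enumerations of \<open>U\<close> and \<open>V\<close>.\<close>

lemma tree_partition_isomorphism:
  assumes C: "tree_partition_on U C" and D: "tree_partition_on V D"
    and "countable U" "countable V"
  obtains g where "bij_betw g U V"
    "\<And>k x y. x \<in> U \<Longrightarrow> y \<in> U \<Longrightarrow> same_cell D k (g x) (g y) \<longleftrightarrow> same_cell C k x y"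
proof -
  interpret C: tree_partition_on U C by fact
  interpret D: tree_partition_on V D by fact
  have ne: "U \<noteq> {}" "V \<noteq> {}"
    using C.infinite_cell[of "[]"] D.infinite_cell[of "[]"] C.root D.root by auto
  let ?P = "\<lambda>p. finite p \<and> p \<subseteq> U \<times> V \<and> partial_iso C D p"
  have "\<exists>f. \<forall>n. ?P (f n) \<and>
      (f n \<subseteq> f (Suc n) \<and> from_nat_into U n \<in> Domain (f (Suc n)) \<and> from_nat_into V n \<in> Range (f (Suc n)))"
  proof (rule dependent_nat_choice[of "\<lambda>_. ?P"])
    show "\<exists>p. ?P p" by (rule exI[of _ "{}"]) (simp add: partial_iso_def)
  next
    fix p n assume p: "?P p"
    have x: "from_nat_into U n \<in> U" and y: "from_nat_into V n \<in> V"
      using from_nat_into[OF ne(1)] from_nat_into[OF ne(2)] by simp_all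
    obtain b where b: "b \<in> V" "partial_iso C D (insert (from_nat_into U n, b) p)"
      using partial_iso_extend[OF C D _ _ _ x] p by blast
    define q where "q = insert (from_nat_into U n, b) p"
    have q: "?P q" using b p x unfolding q_def by auto
    then have "finite (q\<inverse>)" "q\<inverse> \<subseteq> V \<times> U" "partial_iso D C (q\<inverse>)"
      using partial_iso_converse by auto
    then obtain a where a: "a \<in> U" "partial_iso D C (insert (from_nat_into V n, a) (q\<inverse>))"
      using partial_iso_extend[OF D C _ _ _ y] by blast
    have "(insert (from_nat_into V n, a) (q\<inverse>))\<inverse> = insert (a, from_nat_into V n) q" by auto
    then have "partial_iso C D (insert (a, from_nat_into V n) q)"
      using partial_iso_converse[OF a(2)] by simp
    then show "\<exists>p'. ?P p' \<and> (p \<subseteq> p' \<and> from_nat_into U n \<in> Domain p' \<and> from_nat_into V n \<in> Range p')"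
      using q a y by (intro exI[of _ "insert (a, from_nat_into V n) q"]) (auto simp: q_def)
  qed
  then obtain f where f: "\<And>n. ?P (f n)" "\<And>n. f n \<subseteq> f (Suc n)"
    "\<And>n. from_nat_into U n \<in> Domain (f (Suc n))" "\<And>n. from_nat_into V n \<in> Range (f (Suc n))"
    by blast
  have mono: "m \<le> n \<Longrightarrow> f m \<subseteq> f n" for m n using f(2) lift_Suc_mono_le by blast
  define R where "R = (\<Union>n. f n)"
  have R: "R \<subseteq> U \<times> V" using f(1) unfolding R_def by blast
  have iso: "same_cell C k x x' \<longleftrightarrow> same_cell D k y y'" if xy: "(x, y) \<in> R" "(x', y') \<in> R" for x y x' y' k
  proof -
    obtain m n where "(x, y) \<in> f m" "(x', y') \<in> f n" using xy unfolding R_def by blast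
    then have "(x, y) \<in> f (max m n)" "(x', y') \<in> f (max m n)"
      using mono[of m "max m n"] mono[of n "max m n"] by auto
    then show ?thesis using f(1)[of "max m n"] unfolding partial_iso_def by blast
  qed
  have dom: "\<exists>y. (x, y) \<in> R" if "x \<in> U" for x
  proof -
    obtain n where "from_nat_into U n = x" using from_nat_into_surj[OF \<open>countable U\<close> \<open>x \<in> U\<close>] by blast
    then show ?thesis using f(3)[of n] unfolding R_def by blast
  qed
  have ran: "\<exists>x. (x, y) \<in> R" if "y \<in> V" for y
  proof -
    obtain n where "from_nat_into V n = y" using from_nat_into_surj[OF \<open>countable V\<close> \<open>y \<in> V\<close>] by blast
    then show ?thesis using f(4)[of n] unfolding R_def by blast
  qed
  have one: "x = x' \<longleftrightarrow> y = y'" if xy: "(x, y) \<in> R" "(x', y') \<in> R" for x y x' y'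
  proof -
    have "x \<in> U" "x' \<in> U" "y \<in> V" "y' \<in> V" using xy R by auto
    then show ?thesis
      using iso[OF xy] C.separated D.separated C.same_cell_refl D.same_cell_refl by metis
  qed
  obtain g where g: "\<And>x. x \<in> U \<Longrightarrow> (x, g x) \<in> R" using dom by metis
  have "bij_betw g U V"
  proof (rule bij_betw_imageI)
    show "inj_on g U" using g one by (intro inj_onI) blast
    show "g ` U = V"
    proof (intro equalityI subsetI)
      show "y \<in> V" if "y \<in> g ` U" for y using that g R by blast
      fix y assume "y \<in> V"
      then obtain x where "(x, y) \<in> R" using ran by blast
      moreover then have "x \<in> U" using R by blast
      ultimately show "y \<in> g ` U" using g one by blast
    qed
  qed
  then show thesis using that iso g by metis
qed

section \<open>An inductive description of the ideal\<close>

text \<open>\<open>small C X s\<close> is the well-founded form of ``\<open>s\<close> leaves the derivatives of \<open>T_inf C X\<close> at some stage'', with the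
  ordinals replaced by the height of the derivation.\<close>

inductive small :: "(nat list \<Rightarrow> 'a set) \<Rightarrow> 'a set \<Rightarrow> nat list \<Rightarrow> bool" for C X where
  finite: "finite (X \<inter> C s) \<Longrightarrow> small C X s"
| step: "finite F \<Longrightarrow> (\<And>n. n \<notin> F \<Longrightarrow> small C X (s @ [n])) \<Longrightarrow> small C X s"

lemma countable_omega1_strictly_bounded:
  assumes "countable S"
  obtains \<alpha> :: omega1 where "\<And>\<beta>. \<beta> \<in> S \<Longrightarrow> \<beta> < \<alpha>"
proof -
  have "countable (\<Union>\<beta>\<in>S. {..\<beta>})"
    using assms countable_lessThan_omega1
    by (auto simp: ivl_disj_un_singleton(2)[symmetric])
  then obtain \<alpha> where "\<alpha> \<notin> (\<Union>\<beta>\<in>S. {..\<beta>})"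
    using uncountable_omega1 by (metis UNIV_eq_I)
  then show thesis using that by (meson UN_I atMost_iff not_le)
qed

lemma is_succ_exists: "\<exists>\<beta>. is_succ \<alpha> \<beta>"
proof -
  obtain \<gamma> where "\<alpha> < \<gamma>" using countable_omega1_strictly_bounded[of "{\<alpha>}"] by auto
  then have "is_succ \<alpha> (LEAST \<gamma>. \<alpha> < \<gamma>)"
    unfolding is_succ_def by (auto intro: LeastI Least_le)
  then show ?thesis by blast
qed

text \<open>From left to right the stages at which the children of \<open>s\<close> leave have a common countable bound
  \<open>\<alpha>\<close>; at stage \<open>\<alpha>\<close> only finitely many children are left, so \<open>s\<close> is gone one stage later.\<close>

lemma small_iff_deriv_iter:
  "small A X s \<longleftrightarrow> (\<exists>\<alpha>. s \<notin> deriv_iter \<alpha> (T_inf A X))"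
proof
  assume "small A X s"
  then show "\<exists>\<alpha>. s \<notin> deriv_iter \<alpha> (T_inf A X)"
  proof induction
    case (finite s)
    have "deriv_iter (LEAST \<alpha>. True) (T_inf A X) = T_inf A X"
      by (rule deriv_iter_zero) (simp add: Least_le)
    then show ?case using finite unfolding T_inf_def by auto
  next
    case (step F s)
    then obtain r where r: "\<And>n. n \<notin> F \<Longrightarrow> s @ [n] \<notin> deriv_iter (r n) (T_inf A X)" by metis
    obtain \<alpha> where "\<And>n. r n < \<alpha>"
      by (rule countable_omega1_strictly_bounded[of "range r"]) auto
    then have "deriv_iter \<alpha> (T_inf A X) \<subseteq> deriv_iter (r n) (T_inf A X)" for n
      by (intro deriv_iter_antimono less_imp_le)
    then have "Succ (deriv_iter \<alpha> (T_inf A X)) s \<subseteq> F"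
      using r unfolding Succ_def by blast
    then have "finite (Succ (deriv_iter \<alpha> (T_inf A X)) s)"
      using \<open>finite F\<close> finite_subset by blast
    moreover obtain \<beta> where "is_succ \<alpha> \<beta>" using is_succ_exists by blast
    ultimately show ?case
      using deriv_iter_succ unfolding deriv_tree_def by blast
  qed
next
  assume "\<exists>\<alpha>. s \<notin> deriv_iter \<alpha> (T_inf A X)"
  then obtain \<alpha> where "s \<notin> deriv_iter \<alpha> (T_inf A X)" by blast
  then show "small A X s"
  proof (induction \<alpha> arbitrary: s rule: less_induct)
    case (less \<alpha>)
    show ?case
    proof (cases \<alpha> rule: omega1_cases)
      case zero
      then show ?thesis
        using less.prems by (auto simp: deriv_iter_zero T_inf_def intro: small.finite)
    next
      case (succ \<gamma>)
      then have IH: "t \<notin> deriv_iter \<gamma> (T_inf A X) \<Longrightarrow> small A X t" for t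
        using less.IH unfolding is_succ_def by blast
      show ?thesis
      proof (cases "s \<in> deriv_iter \<gamma> (T_inf A X)")
        case True
        then have "finite (Succ (deriv_iter \<gamma> (T_inf A X)) s)"
          using less.prems unfolding deriv_iter_succ[OF succ] deriv_tree_def by blast
        then show ?thesis by (rule small.step) (use IH in \<open>auto simp: Succ_def\<close>)
      qed (rule IH)
    next
      case limit
      then show ?thesis using less unfolding deriv_iter_limit[OF limit] by blast
    qed
  qed
qed

lemma ideal_H_iff_small: "X \<in> ideal_H A \<longleftrightarrow> small A X []"
  unfolding ideal_H_def small_iff_deriv_iter by blast

text \<open>If \<open>s\<close> is small because \<open>X \<inter> C s\<close> is finite, then so are all its children, for the same reason.\<close>

lemma (in tree_partition_on) small_iff_children:
  "small C X s \<longleftrightarrow> finite {n. \<not> small C X (s @ [n])}"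
proof
  assume "small C X s"
  then show "finite {n. \<not> small C X (s @ [n])}"
  proof cases
    case finite
    have "X \<inter> C (s @ [n]) \<subseteq> X \<inter> C s" for n using child_subset by blast
    then have "small C X (s @ [n])" for n using finite by (meson finite_subset small.finite)
    then show ?thesis by simp
  next
    case (step F)
    then show ?thesis by (auto intro: finite_subset[of _ F])
  qed
qed (auto intro: small.step)

lemma small_Cons: "small C X (n # s) \<longleftrightarrow> small (\<lambda>s. C (n # s)) X s"
proof
  show "small (\<lambda>s. C (n # s)) X s" if "small C X (n # s)"
    using that by (induction "n # s" arbitrary: s) (auto intro: small.intros)
  show "small C X (n # s)" if "small (\<lambda>s. C (n # s)) X s"
    using that by induction (auto intro: small.intros)
qed

text \<open>An isometry \<open>g\<close> maps the cell of \<open>x\<close> at each level onto the cell of \<open>g x\<close> at that level. Hence it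
  maps the children of \<open>C s\<close> bijectively to those of \<open>g ` C s\<close>, and a derivation of smallness can be
  copied along \<open>g\<close>. The membership condition on \<open>X\<close> and \<open>Y\<close> concerns \<open>U\<close> only, which makes
  the lemma applicable to \<open>inv_into U g\<close> as well.\<close>

lemma small_transfer:
  assumes "tree_partition_on U C" "tree_partition_on V D"
    and g: "bij_betw g U V"
    and iso: "\<And>k x y. x \<in> U \<Longrightarrow> y \<in> U \<Longrightarrow> same_cell D k (g x) (g y) \<longleftrightarrow> same_cell C k x y"
    and XY: "\<And>x. x \<in> U \<Longrightarrow> g x \<in> Y \<longleftrightarrow> x \<in> X"
    and "small C X s" "length s = length t" "x \<in> C s" "g x \<in> D t"
  shows "small D Y t"
proof -
  interpret C: tree_partition_on U C by fact
  interpret D: tree_partition_on V D by fact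
  have cell: "D t = g ` C s" if len: "length s = length t" and x: "x \<in> C s" "g x \<in> D t" for s t x
  proof (intro equalityI subsetI)
    fix z assume z: "z \<in> D t"
    then obtain y where y: "y \<in> U" "z = g y"
      using g D.cell_subset unfolding bij_betw_def by blast
    have "same_cell D (length t) (g x) (g y)" unfolding same_cell_def using x z y by blast
    then have "same_cell C (length s) x y" using iso y x C.cell_subset len by (metis subsetD)
    then show "z \<in> g ` C s" using C.same_cell_mem x y by blast
  next
    fix z assume "z \<in> g ` C s"
    then obtain y where y: "y \<in> C s" "z = g y" by blast
    have "same_cell C (length s) x y" unfolding same_cell_def using x y by blast
    then have "same_cell D (length t) (g x) (g y)" using iso y x C.cell_subset len by (metis subsetD)
    then show "z \<in> D t" using D.same_cell_mem x y by blast
  qed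
  show ?thesis
    using \<open>small C X s\<close> \<open>length s = length t\<close> \<open>x \<in> C s\<close> \<open>g x \<in> D t\<close>
  proof (induction s arbitrary: t x)
    case (finite s)
    have "D t = g ` C s" using cell finite.prems by blast
    moreover have "g x \<in> Y \<longleftrightarrow> x \<in> X" if "x \<in> C s" for x
      using XY C.cell_subset[of s] that by (simp add: subset_iff)
    ultimately have "Y \<inter> D t = g ` (X \<inter> C s)" by auto
    then show ?case using finite.hyps by (auto intro: small.finite)
  next
    case (step F s)
    have "\<exists>m. D (t @ [m]) = g ` C (s @ [n])" for n
    proof -
      obtain y where y: "y \<in> C (s @ [n])"
        using C.infinite_cell by (metis all_not_in_conv finite.emptyI)
      then have "g y \<in> D t" using cell[OF step.prems] C.child_subset by blast
      then obtain m where "g y \<in> D (t @ [m])" using D.in_child by blast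
      then have "D (t @ [m]) = g ` C (s @ [n])" using y step.prems(1) by (intro cell) auto
      then show ?thesis ..
    qed
    then obtain m where m: "\<And>n. D (t @ [m n]) = g ` C (s @ [n])" by metis
    show ?case
    proof (rule small.step)
      show "finite (m ` F)" using step.hyps by simp
      fix l assume l: "l \<notin> m ` F"
      obtain z where z: "z \<in> D (t @ [l])"
        using D.infinite_cell by (metis all_not_in_conv finite.emptyI)
      then obtain y where y: "y \<in> C s" "z = g y"
        using D.child_subset cell[OF step.prems] by blast
      then obtain n where n: "y \<in> C (s @ [n])" using C.in_child by blast
      then have "l = m n" using m y z D.children_disjoint by blast
      then have "n \<notin> F" using l by blast
      then show "small D Y (t @ [l])"
        using step.IH[of n "t @ [l]" y] n y z step.prems by simp
    qed
  qed
qed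

lemma small_vimage_iff:
  assumes C: "tree_partition_on U C" and D: "tree_partition_on V D"
    and g: "bij_betw g U V"
    and iso: "\<And>k x y. x \<in> U \<Longrightarrow> y \<in> U \<Longrightarrow> same_cell D k (g x) (g y) \<longleftrightarrow> same_cell C k x y"
  shows "small C (g -` Y) [] \<longleftrightarrow> small D Y []"
proof -
  interpret C: tree_partition_on U C by fact
  interpret D: tree_partition_on V D by fact
  obtain x where x: "x \<in> U"
    using C.infinite_cell[of "[]"] C.root by (metis all_not_in_conv finite.emptyI)
  have gx: "g x \<in> V" using g x by (auto simp: bij_betw_def)
  let ?h = "inv_into U g"
  have h: "bij_betw ?h V U" using g by (rule bij_betw_inv_into)
  have gh: "g (?h y) = y" "?h y \<in> U" if "y \<in> V" for y
    using that g h by (auto simp: bij_betw_inv_into_right bij_betw_apply)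
  have iso': "same_cell C k (?h y) (?h z) \<longleftrightarrow> same_cell D k y z" if "y \<in> V" "z \<in> V" for k y z
    using iso[of "?h y" "?h z" k] gh that by simp
  show ?thesis
  proof
    show "small D Y []" if "small C (g -` Y) []"
      using small_transfer[OF C D g iso _ that, of Y "[]" x] x gx C.root D.root by auto
    show "small C (g -` Y) []" if "small D Y []"
      using small_transfer[OF D C h iso' _ that, of "g -` Y" "[]" "g x"] gh gx C.root D.root
      by auto
  qed
qed

text \<open>Here \<open>g n\<close> is an isometry of \<open>\<omega>\<close> with the tree partition \<open>A\<close> onto \<open>A [n]\<close> with the induced one.\<close>

lemma ideal_H_self_similar:
  assumes A: "tree_partition A"
  obtains g :: "nat \<Rightarrow> nat \<Rightarrow> nat" where "inj (\<lambda>(n, x). g n x)"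
    "\<And>X. X \<in> ideal_H A \<longleftrightarrow> finite {n. g n -` X \<notin> ideal_H A}"
proof -
  interpret tree_partition_on UNIV A using A by (rule tree_partition_on_UNIV)
  have "\<exists>g. bij_betw g UNIV (A [n]) \<and> 
      (\<forall>X. g -` X \<in> ideal_H A \<longleftrightarrow> small A X [n])" for n
  proof -
    obtain g where g: "bij_betw g UNIV (A [n])"
      "\<And>k x y. same_cell (\<lambda>s. A (n # s)) k (g x) (g y) \<longleftrightarrow> same_cell A k x y"
      using tree_partition_isomorphism[OF tree_partition_on_axioms subtree[of n]]
      by (metis UNIV_I countableI_type)
    show ?thesis
      using small_vimage_iff[OF tree_partition_on_axioms subtree[of n] g] g(1)
      by (auto simp: ideal_H_iff_small small_Cons)
  qed
  then obtain g where g: "\<And>n. bij_betw (g n) UNIV (A [n])"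
    "\<And>n X. g n -` X \<in> ideal_H A \<longleftrightarrow> small A X [n]"
    by metis
  have "inj (\<lambda>(n, x). g n x)"
  proof (rule injI, clarify)
    fix m x n y assume eq: "g m x = g n y"
    moreover have "g m x \<in> A [m]" "g n y \<in> A [n]" using bij_betw_apply[OF g(1)] by simp_all
    ultimately have "m = n" using children_disjoint[of _ "[]"] by simp
    then show "m = n \<and> x = y" using eq g(1)[of n] by (auto simp: bij_betw_def dest: injD)
  qed
  moreover have "X \<in> ideal_H A \<longleftrightarrow> finite {n. g n -` X \<notin> ideal_H A}" for X
    using small_iff_children[of X "[]"] by (simp add: ideal_H_iff_small[of X A] g(2))
  ultimately show thesis using that by blast
qed

section \<open>Reduced powers of quotients of power sets\<close>

definition ba_closed :: "'a bool_alg \<Rightarrow> bool" where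
  "ba_closed B \<longleftrightarrow>
     (\<forall>x\<in>ba_carrier B. \<forall>y\<in>ba_carrier B. ba_meet B x y \<in> ba_carrier B) \<and>
     (\<forall>x\<in>ba_carrier B. \<forall>y\<in>ba_carrier B. ba_join B x y \<in> ba_carrier B) \<and>
     (\<forall>x\<in>ba_carrier B. ba_compl B x \<in> ba_carrier B) \<and>
     ba_zero B \<in> ba_carrier B \<and> ba_one B \<in> ba_carrier B"

definition ba_congruence :: "'a bool_alg \<Rightarrow> 'a rel \<Rightarrow> bool" where
  "ba_congruence B r \<longleftrightarrow>
     ba_closed B \<and> equiv (ba_carrier B) r \<and>
     (\<forall>(x, x')\<in>r. \<forall>(y, y')\<in>r. (ba_meet B x y, ba_meet B x' y') \<in> r) \<and>
     (\<forall>(x, x')\<in>r. \<forall>(y, y')\<in>r. (ba_join B x y, ba_join B x' y') \<in> r) \<and>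
     (\<forall>(x, x')\<in>r. (ba_compl B x, ba_compl B x') \<in> r)"

lemma ba_quotient_class:
  assumes "ba_congruence B r"
  shows "x \<in> ba_carrier B \<Longrightarrow> y \<in> ba_carrier B \<Longrightarrow>
      ba_meet (ba_quotient B r) (r `` {x}) (r `` {y}) = r `` {ba_meet B x y}"
    and "x \<in> ba_carrier B \<Longrightarrow> y \<in> ba_carrier B \<Longrightarrow>
      ba_join (ba_quotient B r) (r `` {x}) (r `` {y}) = r `` {ba_join B x y}"
    and "x \<in> ba_carrier B \<Longrightarrow> ba_compl (ba_quotient B r) (r `` {x}) = r `` {ba_compl B x}"
    and "ba_zero (ba_quotient B r) = r `` {ba_zero B}"
    and "ba_one (ba_quotient B r) = r `` {ba_one B}"
    and "ba_carrier (ba_quotient B r) = (\<lambda>x. r `` {x}) ` ba_carrier B"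
proof -
  have r: "equiv (ba_carrier B) r" using assms unfolding ba_congruence_def by blast
  have 2: "congruent2 r r (\<lambda>x y. r `` {ba_meet B x y})" "congruent2 r r (\<lambda>x y. r `` {ba_join B x y})"
    by (rule congruent2I'; rule equiv_class_eq[OF r]; use assms in \<open>unfold ba_congruence_def, blast\<close>)+
  have 1: "congruent r (\<lambda>x. r `` {ba_compl B x})"
    by (rule congruentI; rule equiv_class_eq[OF r]; use assms in \<open>unfold ba_congruence_def, blast\<close>)
  show "x \<in> ba_carrier B \<Longrightarrow> y \<in> ba_carrier B \<Longrightarrow>
      ba_meet (ba_quotient B r) (r `` {x}) (r `` {y}) = r `` {ba_meet B x y}"
    "x \<in> ba_carrier B \<Longrightarrow> y \<in> ba_carrier B \<Longrightarrow>
      ba_join (ba_quotient B r) (r `` {x}) (r `` {y}) = r `` {ba_join B x y}"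
    "x \<in> ba_carrier B \<Longrightarrow> ba_compl (ba_quotient B r) (r `` {x}) = r `` {ba_compl B x}"
    by (simp_all add: ba_quotient_def UN_equiv_class2[OF r r] 2 UN_equiv_class[OF r 1])
qed (auto simp: ba_quotient_def quotient_def)

lemma ba_closed_quotient:
  assumes "ba_congruence B r"
  shows "ba_closed (ba_quotient B r)"
proof -
  have "ba_closed B" using assms unfolding ba_congruence_def by blast
  then show ?thesis
    unfolding ba_closed_def ba_quotient_class(4-6)[OF assms]
    by (auto simp: ba_quotient_class(1-3)[OF assms])
qed

text \<open>The first isomorphism theorem: a surjective homomorphism \<open>F\<close> with kernel \<open>r\<close> induces an isomorphism
  on the quotient.\<close>

lemma ba_isomorphic_quotient:
  assumes r: "ba_congruence B r"
    and F: "F ` ba_carrier B = ba_carrier Q"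
    and kernel: "\<And>x y. x \<in> ba_carrier B \<Longrightarrow> y \<in> ba_carrier B \<Longrightarrow> F x = F y \<longleftrightarrow> (x, y) \<in> r"
    and meet: "\<And>x y. x \<in> ba_carrier B \<Longrightarrow> y \<in> ba_carrier B \<Longrightarrow> F (ba_meet B x y) = ba_meet Q (F x) (F y)"
    and join: "\<And>x y. x \<in> ba_carrier B \<Longrightarrow> y \<in> ba_carrier B \<Longrightarrow> F (ba_join B x y) = ba_join Q (F x) (F y)"
    and compl: "\<And>x. x \<in> ba_carrier B \<Longrightarrow> F (ba_compl B x) = ba_compl Q (F x)"
    and zero: "F (ba_zero B) = ba_zero Q" and one: "F (ba_one B) = ba_one Q"
  shows "ba_isomorphic (ba_quotient B r) Q"
proof -
  let ?c = "ba_carrier B"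
  have eqv: "equiv ?c r" and cl: "ba_closed B" using r unfolding ba_congruence_def by blast+
  define h where "h = (\<lambda>K. F (SOME x. x \<in> K))"
  have h: "h (r `` {x}) = F x" if x: "x \<in> ?c" for x
  proof -
    have *: "(x, SOME y. y \<in> r `` {x}) \<in> r"
      using equiv_class_self[OF eqv x] someI[of "\<lambda>y. y \<in> r `` {x}" x] by blast
    then have "(SOME y. y \<in> r `` {x}) \<in> ?c" using eqv unfolding equiv_def by blast
    then show ?thesis unfolding h_def using kernel x * by metis
  qed
  have carrier: "ba_carrier (ba_quotient B r) = (\<lambda>x. r `` {x}) ` ?c"
    using ba_quotient_class(6)[OF r] .
  have "h \<in> ba_iso (ba_quotient B r) Q"
    unfolding ba_iso_def mem_Collect_eq carrier
  proof (intro conjI)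
    have "inj_on h ((\<lambda>x. r `` {x}) ` ?c)"
      by (rule inj_onI, elim imageE) (simp add: h kernel equiv_class_eq[OF eqv])
    then show "bij_betw h ((\<lambda>x. r `` {x}) ` ?c) (ba_carrier Q)"
      using F h by (simp add: bij_betw_def image_image cong: image_cong)
  qed (use cl in \<open>auto simp: h ba_quotient_class[OF r] meet join compl zero one ba_closed_def\<close>)
  then show ?thesis unfolding ba_isomorphic_def by blast
qed

definition Fin_rel :: "'a set \<Rightarrow> (nat \<Rightarrow> 'a) rel" where
  "Fin_rel S = {(a, b). a \<in> UNIV \<rightarrow> S \<and> b \<in> UNIV \<rightarrow> S \<and> finite {n. a n \<noteq> b n}}"

lemma reduced_power_Fin_eq:
  "reduced_power_Fin B = ba_quotient (ba_power B) (Fin_rel (ba_carrier B))"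
  unfolding reduced_power_Fin_def Fin_rel_def by (simp add: ba_power_def)

lemma ba_congruence_Fin_rel:
  assumes "ba_closed B"
  shows "ba_congruence (ba_power B) (Fin_rel (ba_carrier B))"
proof -
  have fin: "finite {n. f (a n) (b n) \<noteq> f (a' n) (b' n)}"
    if "finite {n. a n \<noteq> a' n}" "finite {n. b n \<noteq> b' n}" for a a' b b' and f :: "'a \<Rightarrow> 'a \<Rightarrow> 'a"
    by (rule finite_subset[OF _ finite_UnI[OF that]]) auto
  have fin1: "finite {n. f (a n) \<noteq> f (a' n)}"
    if "finite {n. a n \<noteq> a' n}" for a a' and f :: "'a \<Rightarrow> 'a"
    by (rule finite_subset[OF _ that]) auto
  have "trans (Fin_rel (ba_carrier B))"
  proof (rule transI)
    fix a b c assume *: "(a, b) \<in> Fin_rel (ba_carrier B)" "(b, c) \<in> Fin_rel (ba_carrier B)"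
    then have "finite ({n. a n \<noteq> b n} \<union> {n. b n \<noteq> c n})" unfolding Fin_rel_def by simp
    then have "finite {n. a n \<noteq> c n}" by (rule finite_subset[rotated]) auto
    then show "(a, c) \<in> Fin_rel (ba_carrier B)" using * unfolding Fin_rel_def by simp
  qed
  moreover have "sym (Fin_rel (ba_carrier B))"
    by (rule symI) (simp add: Fin_rel_def eq_commute)
  ultimately have "equiv (ba_carrier (ba_power B)) (Fin_rel (ba_carrier B))"
    by (intro equivI) (auto simp: Fin_rel_def ba_power_def refl_on_def)
  moreover have "ba_closed (ba_power B)"
    using assms unfolding ba_closed_def ba_power_def by (auto simp: Pi_iff)
  ultimately show ?thesis
    using assms fin fin1 unfolding ba_congruence_def ba_closed_def
    by (auto simp: Fin_rel_def ba_power_def Pi_iff)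
qed

lemma ba_congruence_ideal:
  assumes "{} \<in> I"
    and Un: "\<And>X Y. X \<in> I \<Longrightarrow> Y \<in> I \<Longrightarrow> X \<union> Y \<in> I"
    and sub: "\<And>X Y. X \<in> I \<Longrightarrow> Y \<subseteq> X \<Longrightarrow> Y \<in> I"
  shows "ba_congruence ba_powerset {(X, Y). sym_diff X Y \<in> I}"
proof -
  have Un_sub: "Z \<in> I" if "X \<in> I" "Y \<in> I" "Z \<subseteq> X \<union> Y" for X Y Z
    using that Un sub by blast
  have "trans {(X, Y). sym_diff X Y \<in> I}"
  proof (rule transI, clarify)
    fix X Y Z assume "sym_diff X Y \<in> I" "sym_diff Y Z \<in> I"
    then show "sym_diff X Z \<in> I" by (rule Un_sub) blast
  qed
  then have "equiv UNIV {(X, Y). sym_diff X Y \<in> I}"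
    by (intro equivI) (auto simp: refl_on_def sym_def assms(1) Un_commute)
  moreover have "sym_diff (X \<inter> Y) (X' \<inter> Y') \<in> I" "sym_diff (X \<union> Y) (X' \<union> Y') \<in> I"
    if "sym_diff X X' \<in> I" "sym_diff Y Y' \<in> I" for X X' Y Y'
    by (rule Un_sub[OF that], blast)+
  moreover have "sym_diff (- X) (- Y) \<in> I" if "sym_diff X Y \<in> I" for X Y
    by (rule sub[OF that]) blast
  ultimately show ?thesis
    by (simp add: ba_congruence_def ba_closed_def ba_powerset_def split_def)
qed

text \<open>The homomorphism \<open>X \<mapsto> \<langle>[g n -` X]\<rangle>\<close> has kernel \<open>I\<close> by the self-similarity of \<open>I\<close>. It is onto: the
  ranges of the injections \<open>g n\<close> are disjoint, so the set \<open>(\<Union>n. g n ` Y n)\<close> has the prescribed preimages \<open>Y n\<close>.\<close>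

lemma powerset_mod_isomorphic_reduced_power:
  fixes g :: "nat \<Rightarrow> 'a \<Rightarrow> 'a"
  assumes ideal: "{} \<in> I" "\<And>X Y. X \<in> I \<Longrightarrow> Y \<in> I \<Longrightarrow> X \<union> Y \<in> I"
      "\<And>X Y. X \<in> I \<Longrightarrow> Y \<subseteq> X \<Longrightarrow> Y \<in> I"
    and inj: "inj (\<lambda>(n, x). g n x)"
    and I: "\<And>X. X \<in> I \<longleftrightarrow> finite {n. g n -` X \<notin> I}"
  shows "ba_isomorphic (powerset_mod I) (reduced_power_Fin (powerset_mod I))"
proof -
  define r where "r = {(X, Y). sym_diff X Y \<in> I}"
  define B where "B = powerset_mod I"
  define q where "q = Fin_rel (ba_carrier B)"
  have B_eq: "B = ba_quotient ba_powerset r" unfolding B_def r_def powerset_mod_def ..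
  have r: "ba_congruence ba_powerset r"
    unfolding r_def by (rule ba_congruence_ideal) (use ideal in blast)+
  have q: "ba_congruence (ba_power B) q"
    unfolding q_def B_eq by (intro ba_congruence_Fin_rel ba_closed_quotient r)
  have q_equiv: "equiv (UNIV \<rightarrow> ba_carrier B) q"
    using q unfolding ba_congruence_def by (simp add: ba_power_def)
  have R_eq: "reduced_power_Fin B = ba_quotient (ba_power B) q"
    unfolding q_def by (rule reduced_power_Fin_eq)
  have cls: "r `` {X} = r `` {Y} \<longleftrightarrow> sym_diff X Y \<in> I" for X Y
    using eq_equiv_class_iff[of UNIV r X Y] r
    unfolding ba_congruence_def by (simp add: ba_powerset_def r_def)
  define e where "e = (\<lambda>X n. r `` {g n -` X})"
  have e: "e X \<in> UNIV \<rightarrow> ba_carrier B" for X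
    unfolding e_def B_eq ba_quotient_class(6)[OF r] by (simp add: ba_powerset_def)
  then have e': "e X \<in> ba_carrier (ba_power B)" for X by (simp add: ba_power_def)
  have ker: "q `` {e X} = q `` {e Y} \<longleftrightarrow> (X, Y) \<in> r" for X Y
  proof -
    have "q `` {e X} = q `` {e Y} \<longleftrightarrow> finite {n. e X n \<noteq> e Y n}"
      using eq_equiv_class_iff[OF q_equiv e e] e unfolding q_def Fin_rel_def by simp
    also have "\<dots> \<longleftrightarrow> finite {n. g n -` (sym_diff X Y) \<notin> I}"
      unfolding e_def cls by (simp add: vimage_Diff vimage_Un)
    also have "\<dots> \<longleftrightarrow> (X, Y) \<in> r" using I[of "sym_diff X Y"] unfolding r_def by simp
    finally show ?thesis .
  qed
  have surj: "\<exists>X. a = e X" if a: "a \<in> UNIV \<rightarrow> ba_carrier B" for a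
  proof -
    have "\<exists>Y. a n = r `` {Y}" for n
      using a unfolding B_eq ba_quotient_class(6)[OF r] by blast
    then obtain Y where Y: "\<And>n. a n = r `` {Y n}" by metis
    have "g n -` (\<Union>m. g m ` Y m) = Y n" for n
      using inj unfolding inj_def by auto
    then have "a = e (\<Union>m. g m ` Y m)" unfolding e_def using Y by auto
    then show ?thesis ..
  qed
  have "ba_isomorphic (ba_quotient ba_powerset r) (reduced_power_Fin B)"
  proof (rule ba_isomorphic_quotient[OF r, where F = "\<lambda>X. q `` {e X}"])
    show "(\<lambda>X. q `` {e X}) ` ba_carrier ba_powerset = ba_carrier (reduced_power_Fin B)"
    proof -
      have "range e = UNIV \<rightarrow> ba_carrier B" using e surj by blast
      then have "(\<lambda>X. q `` {e X}) ` UNIV = (\<lambda>a. q `` {a}) ` (UNIV \<rightarrow> ba_carrier B)"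
        unfolding image_image[of "\<lambda>a. q `` {a}" e, symmetric] by simp
      then show ?thesis
        unfolding R_eq ba_quotient_class(6)[OF q] by (simp add: ba_power_def ba_powerset_def)
    qed
  next
    fix X Y
    have "e (X \<inter> Y) = ba_meet (ba_power B) (e X) (e Y)" "e (X \<union> Y) = ba_join (ba_power B) (e X) (e Y)"
      "e (- X) = ba_compl (ba_power B) (e X)"
      unfolding e_def using ba_quotient_class[OF r]
      by (simp_all add: ba_power_def B_eq ba_powerset_def vimage_Compl)
    then show "q `` {e (ba_meet ba_powerset X Y)} = ba_meet (reduced_power_Fin B) (q `` {e X}) (q `` {e Y})"
      "q `` {e (ba_join ba_powerset X Y)} = ba_join (reduced_power_Fin B) (q `` {e X}) (q `` {e Y})"
      "q `` {e (ba_compl ba_powerset X)} = ba_compl (reduced_power_Fin B) (q `` {e X})"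
      unfolding R_eq by (simp_all add: ba_quotient_class[OF q] e' ba_powerset_def)
  next
    have "ba_zero B = r `` {ba_zero ba_powerset}" "ba_one B = r `` {ba_one ba_powerset}"
      unfolding B_eq by (rule ba_quotient_class[OF r])+
    then show "q `` {e (ba_zero ba_powerset)} = ba_zero (reduced_power_Fin B)"
      "q `` {e (ba_one ba_powerset)} = ba_one (reduced_power_Fin B)"
      unfolding R_eq ba_quotient_class(4,5)[OF q]
      by (simp_all add: e_def ba_power_def ba_powerset_def)
  qed (use ker in auto)
  then show ?thesis using B_eq unfolding B_def by simp
qed

theorem corollary8p3:
  fixes A :: "nat list \<Rightarrow> nat set"
  assumes "tree_partition A"
  shows "ba_isomorphic (powerset_mod (ideal_H A)) (reduced_power_Fin (powerset_mod (ideal_H A)))"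
proof -
  obtain g :: "nat \<Rightarrow> nat \<Rightarrow> nat" where "inj (\<lambda>(n, x). g n x)"
    "\<And>X. X \<in> ideal_H A \<longleftrightarrow> finite {n. g n -` X \<notin> ideal_H A}"
    using ideal_H_self_similar[OF assms] by blast
  then show ?thesis
    by (rule powerset_mod_isomorphic_reduced_power[rotated 3])
      (auto intro: ideal_H_finite ideal_H_Un[OF assms] ideal_H_subset)
qed

end
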